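(* (In ZFC.) Let $r\geq3$ be an integer, $\kappa>0$ a cardinal, $\tau>0$ an ordinal, and $\lambda_\xi\geq r+1$ cardinals for $\xi<\tau$. If $\kappa\nrightarrow(\lambda_\xi)^r_{\xi<\tau}$, then \[ 2^\kappa\nrightarrow\big((\lambda_\xi+1)_{\xi<\tau},\underbrace{r+2,\dots,r+2}_{\eta(r)\text{ terms}}\big)^{r+1}, \] i.e. there is a colouring $g:\binom{2^\kappa}{r+1}\to\tau\oplus\eta(r)$ such that for no $\xi<\tau$ is there a set of cardinality $\lambda_\xi+1$ (cardinal addition) monochromatic in colour $\xi$, and for no $j<\eta(r)$ is there a set of cardinality $r+2$ monochromatic in colour $\tau\oplus j$. Here $\eta(r)=1$ if $r=3$, $\eta(r)=2$ if $r>3$ is even, $\eta(r)=3$ if $r>3$ is odd.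
   Context: Von Neumann ordinals are used; $\oplus$ denotes ordinal addition, $+$ cardinal addition, and $\binom{A}{r}$ the set of $r$-element subsets of $A$. For an integer $r\geq2$, an ordinal $\tau>0$, a cardinal $\kappa>0$ and cardinals $\lambda_\xi\geq r+1$ ($\xi<\tau$): a set $X\subset\kappa$ is monochromatic in colour $\xi$ under $f:\binom{\kappa}{r}\to\tau$ if $f(T)=\xi$ for all $T\in\binom{X}{r}$; $\kappa\nrightarrow(\lambda_\xi)^r_{\xi<\tau}$ means there is some $f:\binom{\kappa}{r}\to\tau$ such that there is no $\xi<\tau$ and $X\subset\kappa$ monochromatic in colour $\xi$ with $|X|=\lambda_\xi$. *)

theory Defs
  imports Main "HOL-Library.Ramsey"
begin

text \<open>Cardinals are represented by sets (compared via card_of, with ordLeq / ordIso).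
  The ordinal tau of colours is represented by an index set T; the colour set
  tau (+) eta is represented by the disjoint sum T <+> {..<eta}, where Inl xi is colour xi
  and Inr j is colour tau (+) j.\<close>

definition monochromatic :: "('a set \<Rightarrow> 'c) \<Rightarrow> nat \<Rightarrow> 'a set \<Rightarrow> 'c \<Rightarrow> bool" where
  "monochromatic f r X c \<longleftrightarrow> (\<forall>S \<in> nsets X r. f S = c)"

definition neg_arrow :: "'a set \<Rightarrow> 'c set \<Rightarrow> ('c \<Rightarrow> 'l set) \<Rightarrow> nat \<Rightarrow> bool" where
  "neg_arrow K T L r \<longleftrightarrow>
     (\<exists>f :: 'a set \<Rightarrow> 'c. (\<forall>S \<in> nsets K r. f S \<in> T) \<and>
        \<not> (\<exists>\<xi>\<in>T. \<exists>X. X \<subseteq> K \<and> (card_of X, card_of (L \<xi>)) \<in> ordIso \<and> monochromatic f r X \<xi>))"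

definition eta :: "nat \<Rightarrow> nat" where
  "eta r = (if r = 3 then 1 else if even r then 2 else 3)"

end

theory Submission
  imports Defs
begin

text \<open>Well-order the points and order their subsets lexicographically; \<open>delta x y\<close> is the
  first point at which x and y differ. An (r+1)-set of subsets spans a binary tree with r+1
  leaves. If the tree is a caterpillar (all branching points lie on one path), it has r distinct
  branching levels, and the set gets the f-colour of these levels. Otherwise the consecutive
  deltas have an interior local minimum (a valley), and the colour is read off from the position of
  the first valley and the existence of a second one, in such a way that deleting the least and
  the largest element of an (r+2)-set with a valley always gives different colours. Hence every
  monochromatic set of size at least r+2 is a caterpillar. This excludes the additional
  colours at once; and a caterpillar X has at least \<open>|X|\<close> - 1 levels, every r of which are the
  levels of some (r+1)-subset, so that X of size \<open>\<lambda> + 1\<close> gives a set of size \<open>\<lambda>\<close> monochromatic for f.\<close>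

section \<open>Valleys in words of ascents and descents\<close>

fun valley :: "bool list \<Rightarrow> bool" where
  "valley (a # b # w) \<longleftrightarrow> \<not> a \<and> b \<or> valley (b # w)"
| "valley _ \<longleftrightarrow> False"

fun valley_pos :: "bool list \<Rightarrow> nat" where
  "valley_pos (a # b # w) = (if \<not> a \<and> b then 1 else Suc (valley_pos (b # w)))"
| "valley_pos _ = 0"

text \<open>A word records the ascents (\<open>True\<close>) and descents (\<open>False\<close>) of a sequence of deltas. A word
  with a valley at position 1 and a further valley returns \<open>None\<close>, hence shares an old colour with
  the caterpillars: for this reason two additional colours suffice for even r and one for r = 3.\<close>

definition extra_colour :: "nat \<Rightarrow> bool list \<Rightarrow> nat option" where
  "extra_colour r w =
     (if \<not> valley w then None
      else if valley_pos w = 1 then (if valley (tl w) then None else Some (eta r - 1))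
      else Some (valley_pos w mod 2))"

lemma valley_pos_bounds: "valley w \<Longrightarrow> 1 \<le> valley_pos w \<and> valley_pos w < length w"
  by (induction w rule: valley_pos.induct) auto

lemma valley_butlast: "valley (butlast w) \<Longrightarrow> valley w \<and> valley_pos (butlast w) = valley_pos w"
proof (induction w rule: valley_pos.induct)
  case (1 a b w)
  then show ?case by (cases w) (auto split: if_splits)
qed auto

lemma valley_pos_last:
  "valley w \<Longrightarrow> \<not> valley (butlast w) \<Longrightarrow> valley_pos w = length w - 1"
proof (induction w rule: valley_pos.induct)
  case (1 a b w)
  then show ?case by (cases w) (auto split: if_splits)
qed auto

lemma valley_tl:
  "valley w \<Longrightarrow> valley_pos w \<noteq> 1 \<Longrightarrow> valley (tl w) \<and> valley_pos (tl w) = valley_pos w - 1"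
  by (induction w rule: valley_pos.induct) (auto split: if_splits)

lemma valley_True_Cons:
  assumes "valley (True # w)"
  shows "valley w \<and> valley_pos (True # w) = Suc (valley_pos w)"
  using assms by (cases w) simp_all

text \<open>Valleys are never adjacent: the one at position 1 ends in an ascent, whereas a valley at
  position 1 of the tail would begin with a descent at that very letter.\<close>

lemma valley_pos_tl_neq_1:
  assumes p: "valley_pos w = 1" and v: "valley (tl w)"
  shows "valley_pos (tl w) \<noteq> 1"
proof -
  obtain a b u where w: "w = a # b # u" using v by (metis list.sel(2,3) neq_Nil_conv valley.simps(2,3))
  have v': "valley (b # u)" using v unfolding w by simp
  have b: "b"
  proof (rule ccontr)
    assume "\<not> b"
    then have "valley_pos w = Suc (valley_pos (b # u))" unfolding w by simp
    then show False using p valley_pos_bounds[OF v'] by linarith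
  qed
  have v'': "valley (True # u)" using v' b by simp
  have "valley_pos (True # u) \<noteq> 1"
    using valley_True_Cons[OF v''] valley_pos_bounds[of u] by simp
  then show ?thesis using b unfolding w by simp
qed

text \<open>For the word of r+2 points, \<open>tl\<close> and \<open>butlast\<close> are the words
  left after removing the least and the largest point. Removing the first letter moves the first
  valley by one and flips its parity; the other colours settle the cases in which a valley is lost
  at an end of the word or arrives at position 1.\<close>

lemma extra_colour_tl_neq_butlast:
  assumes "length w = r" "r \<ge> 3" "valley w"
  shows "extra_colour r (tl w) \<noteq> extra_colour r (butlast w)"
proof (cases "valley_pos w = 1")
  case True
  have bl: "valley (butlast w)" using valley_pos_last[OF assms(3)] True assms by fastforce
  have blp: "valley_pos (butlast w) = 1" using valley_butlast[OF bl] True by simp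
  show ?thesis
  proof (cases "valley (tl w)")
    case False
    then have "\<not> valley (tl (butlast w))" using valley_butlast[of "tl w"] by (auto simp: butlast_tl)
    then show ?thesis using False bl blp by (simp add: extra_colour_def)
  next
    case tl: True
    have p: "valley_pos (tl w) \<noteq> 1" by (rule valley_pos_tl_neq_1[OF True tl])
    have c: "extra_colour r (tl w) = Some (valley_pos (tl w) mod 2)"
      using p tl by (simp add: extra_colour_def)
    show ?thesis
    proof (cases "valley (butlast (tl w))")
      case True
      then show ?thesis using c bl blp by (simp add: extra_colour_def butlast_tl)
    next
      case False
      \<comment> \<open>The second valley is at the very end, so \<open>tl w\<close> gets the parity
        of \<open>r\<close> and \<open>butlast w\<close> gets \<open>eta r - 1\<close>. This is why
        \<open>eta\<close> depends on that parity: 0 against 1 for even \<open>r\<close>, 1 against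
        2 for odd \<open>r\<close>.\<close>
      have q: "valley_pos (tl w) = r - 2" using valley_pos_last[OF tl False] assms by simp
      have "r \<ge> 4" using q p assms by (cases "r = 3") auto
      have "(r - 2) mod 2 = r mod 2" using \<open>r \<ge> 4\<close> by (simp add: le_mod_geq)
      then have "(r - 2) mod 2 \<noteq> eta r - 1"
        using \<open>r \<ge> 4\<close> by (cases "even r") (simp_all add: eta_def mod_2_eq_odd)
      then show ?thesis using c q bl blp False by (simp add: extra_colour_def butlast_tl)
    qed
  qed
next
  case False
  have tl: "valley (tl w)" "valley_pos (tl w) = valley_pos w - 1" using valley_tl[OF assms(3) False] by auto
  have ge: "valley_pos w \<ge> 2" using valley_pos_bounds[OF assms(3)] False by simp
  show ?thesis
  proof (cases "valley (butlast w)")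
    case True
    have bp: "valley_pos (butlast w) = valley_pos w" using valley_butlast[OF True] by simp
    then have "r \<ge> 4" using valley_pos_bounds[OF True] ge assms by simp
    \<comment> \<open>For the case \<open>valley_pos w = 2\<close>: then \<open>tl w\<close> has its
      valley at position 1 and gets \<open>eta r - 1\<close> or \<open>None\<close>, while
      \<open>butlast w\<close> gets 0.\<close>
    then have "eta r - 1 \<noteq> 0" by (simp add: eta_def)
    moreover have "(valley_pos w - 1) mod 2 \<noteq> valley_pos w mod 2"
      using ge by (cases "valley_pos w") (auto simp: mod_Suc)
    ultimately show ?thesis using True bp tl False ge
      by (auto simp: extra_colour_def split: if_splits)
  next
    case bl: False
    have q: "valley_pos w = r - 1" using valley_pos_last[OF assms(3) bl] assms by simp
    \<comment> \<open>The assumption forces \<open>r = 3\<close>. Since \<open>butlast w\<close>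
      gets no additional colour, \<open>tl w\<close> must get one, so it may not have a second
      valley.\<close>
    have "\<not> valley (tl (tl w))" if "valley_pos (tl w) = 1"
    proof
      assume "valley (tl (tl w))"
      from valley_pos_bounds[OF this] show False using that tl q assms by simp
    qed
    then show ?thesis using bl tl by (auto simp: extra_colour_def)
  qed
qed

text \<open>For \<open>r = 3\<close> the word has two letters, so a valley can only be at position
  1: the parity colours do not occur and \<open>eta r - 1 = 0\<close> is the single colour. For
  larger \<open>r\<close> both parities are below \<open>eta r\<close>.\<close>

lemma extra_colour_less_eta:
  assumes "extra_colour r w = Some j" "length w = r - 1" "r \<ge> 3"
  shows "j < eta r"
proof (cases "valley_pos w = 1")
  case True
  then show ?thesis using assms by (auto simp: extra_colour_def eta_def split: if_splits)
next
  case False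
  then have "valley w" "j = valley_pos w mod 2" using assms by (auto simp: extra_colour_def split: if_splits)
  moreover from this have "r \<noteq> 3" using valley_pos_bounds[of w] False assms by auto
  ultimately show ?thesis by (auto simp: eta_def mod_2_eq_odd)
qed

section \<open>First differences and the lexicographic order of sets\<close>

context wellorder
begin

definition delta :: "'a set \<Rightarrow> 'a set \<Rightarrow> 'a" where
  "delta x y = (LEAST m. m \<in> x \<longleftrightarrow> m \<notin> y)"

lemma delta_commute: "delta x y = delta y x"
  unfolding delta_def by (rule arg_cong[where f = Least]) auto

lemma delta_differ: "x \<noteq> y \<Longrightarrow> delta x y \<in> x \<longleftrightarrow> delta x y \<notin> y"
  unfolding delta_def by (rule LeastI_ex) blast

lemma delta_agree: "m < delta x y \<Longrightarrow> m \<in> x \<longleftrightarrow> m \<in> y"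
  unfolding delta_def using not_less_Least by blast

lemma delta_eqI:
  assumes "d \<in> x \<longleftrightarrow> d \<notin> y" and "\<And>m. m < d \<Longrightarrow> m \<in> x \<longleftrightarrow> m \<in> y"
  shows "delta x y = d"
  unfolding delta_def by (rule Least_equality) (use assms not_le in blast)+

lemma delta_mem: "x \<noteq> y \<Longrightarrow> x \<subseteq> K \<Longrightarrow> y \<subseteq> K \<Longrightarrow> delta x y \<in> K"
  using delta_differ by blast

text \<open>Since \<open>y\<close> and \<open>z\<close> still agree where \<open>x\<close> and
  \<open>y\<close> part, \<open>x\<close> and \<open>z\<close> part there too: the ultrametric law
  of the binary tree.\<close>

lemma delta_less:
  assumes "x \<noteq> y" "delta x y < delta y z"
  shows "delta x z = delta x y"
proof (rule delta_eqI)
  show "delta x y \<in> x \<longleftrightarrow> delta x y \<notin> z"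
    using delta_differ[OF assms(1)] delta_agree[OF assms(2)] by simp
  show "m \<in> x \<longleftrightarrow> m \<in> z" if "m < delta x y" for m
    using delta_agree[OF that] delta_agree[OF less_trans[OF that assms(2)]] by simp
qed

text \<open>A point either belongs to a set or does not, so three sets cannot pairwise differ at one
  point: branching is binary.\<close>

lemma delta_eq_less:
  assumes "x \<noteq> y" "y \<noteq> z" "x \<noteq> z" "delta x y = delta y z"
  shows "delta x y < delta x z"
proof (rule ccontr)
  assume "\<not> delta x y < delta x z"
  then consider "delta x z = delta x y" | "delta x z < delta x y" using neq_iff by blast
  then show False
  proof cases
    case 1
    then show ?thesis using delta_differ[of x y] delta_differ[of y z] delta_differ[of x z] assms by auto
  next
    case 2
    then show ?thesis
      using delta_agree[of "delta x z" x y] delta_agree[of "delta x z" y z] delta_differ[of x z] assms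
      by auto
  qed
qed

definition lex :: "'a set \<Rightarrow> 'a set \<Rightarrow> bool" where
  "lex x y \<longleftrightarrow> x \<noteq> y \<and> delta x y \<in> y"

lemma lex_neq: "lex x y \<Longrightarrow> x \<noteq> y"
  by (simp add: lex_def)

text \<open>The first level belongs to \<open>y\<close>, the second does not. Hence a letter
  \<open>False\<close> in the \<open>delta_word\<close> of a sorted list is a strict
  descent.\<close>

lemma lex_delta_neq: "lex x y \<Longrightarrow> lex y z \<Longrightarrow> delta x y \<noteq> delta y z"
  using delta_differ[of y z] by (auto simp: lex_def)

lemma lex_linear: "x \<noteq> y \<Longrightarrow> lex x y \<or> lex y x"
  using delta_differ[of x y] by (auto simp: lex_def delta_commute)

lemma lex_asym: "lex x y \<Longrightarrow> \<not> lex y x"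
  using delta_differ[of x y] by (auto simp: lex_def delta_commute)

lemma lex_min:
  assumes "lex x y" "lex y z"
  shows "lex x z" "delta x z \<le> delta x y" "delta x z \<le> delta y z"
    "delta x z = delta x y \<or> delta x z = delta y z"
proof -
  have "lex x z \<and> delta x z \<le> delta x y \<and> delta x z \<le> delta y z
    \<and> (delta x z = delta x y \<or> delta x z = delta y z)"
  proof (cases "delta x y < delta y z")
    case True
    have e: "delta x z = delta x y" by (rule delta_less[OF lex_neq[OF assms(1)] True])
    have "delta x y \<in> z" "delta x y \<notin> x"
      using assms delta_agree[OF True] delta_differ[of x y] by (auto simp: lex_def)
    then show ?thesis using e True unfolding lex_def by auto
  next
    case False
    then have lt: "delta z y < delta y x"
      using lex_delta_neq[OF assms] by (simp add: delta_commute)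
    have e: "delta x z = delta y z"
      using delta_less[OF _ lt] lex_neq[OF assms(2)] by (metis delta_commute)
    have "delta y z \<in> z" "delta y z \<notin> x"
      using assms delta_agree[OF lt] delta_differ[of y z] by (auto simp: lex_def delta_commute)
    then show ?thesis using e False unfolding lex_def by auto
  qed
  then show "lex x z" "delta x z \<le> delta x y" "delta x z \<le> delta y z"
    "delta x z = delta x y \<or> delta x z = delta y z" by auto
qed

lemma lex_linorder: "class.linorder (\<lambda>x y. x = y \<or> lex x y) lex"
proof
  fix x y z
  show "lex x y \<longleftrightarrow> (x = y \<or> lex x y) \<and> \<not> (y = x \<or> lex y x)"
    using lex_asym[of x y] lex_neq[of x y] by auto
  show "x = z \<or> lex x z" if "x = y \<or> lex x y" "y = z \<or> lex y z"
    using that lex_min(1)[of x y z] by auto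
  show "x = y" if "x = y \<or> lex x y" "y = x \<or> lex y x"
    using that lex_asym[of x y] by auto
  show "(x = y \<or> lex x y) \<or> y = x \<or> lex y x"
    using lex_linear[of x y] by auto
qed simp

definition lex_list :: "'a set set \<Rightarrow> 'a set list" where
  "lex_list S = (THE xs. sorted_wrt lex xs \<and> set xs = S)"

lemma lex_list_set:
  assumes "sorted_wrt lex xs"
  shows "lex_list (set xs) = xs"
proof -
  interpret lex: linorder "\<lambda>x y. x = y \<or> lex x y" lex by (rule lex_linorder)
  show ?thesis unfolding lex_list_def
    by (rule the_equality) (use assms in \<open>auto intro: lex.strict_sorted_equal\<close>)
qed

lemma lex_list:
  assumes "finite S"
  shows "sorted_wrt lex (lex_list S)" "set (lex_list S) = S" "length (lex_list S) = card S"
proof -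
  interpret lex: linorder "\<lambda>x y. x = y \<or> lex x y" lex by (rule lex_linorder)
  have "sorted_wrt lex (lex.sorted_list_of_set S)" "set (lex.sorted_list_of_set S) = S"
    "length (lex.sorted_list_of_set S) = card S"
    using assms by (simp_all add: lex.strict_sorted_list_of_set)
  moreover from this have "lex_list S = lex.sorted_list_of_set S"
    using lex_list_set[of "lex.sorted_list_of_set S"] by simp
  ultimately show "sorted_wrt lex (lex_list S)" "set (lex_list S) = S" "length (lex_list S) = card S"
    by simp_all
qed

section \<open>Forks and valleys\<close>

fun delta_word :: "'a set list \<Rightarrow> bool list" where
  "delta_word (x # y # z # xs) = (delta x y < delta y z) # delta_word (y # z # xs)"
| "delta_word _ = []"

lemma length_delta_word: "length (delta_word xs) = length xs - 2"
  by (induction xs rule: delta_word.induct) auto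

lemma delta_word_tl: "delta_word (tl xs) = tl (delta_word xs)"
  by (induction xs rule: delta_word.induct) auto

lemma delta_word_butlast: "delta_word (butlast xs) = butlast (delta_word xs)"
proof (induction xs rule: delta_word.induct)
  case (1 x y z xs)
  then show ?case by (cases xs) auto
qed auto

text \<open>Two incomparable branching points, x, y meeting above one and u, v above the other. Stated
  without the lexicographic order, unlike the valleys of \<open>delta_word\<close>.\<close>

definition fork :: "'a set set \<Rightarrow> bool" where
  "fork X \<longleftrightarrow> (\<exists>x\<in>X. \<exists>y\<in>X. \<exists>u\<in>X. \<exists>v\<in>X. x \<noteq> y \<and> x \<noteq> u \<and> u \<noteq> v \<and>
     delta x u < delta x y \<and> delta x u < delta u v)"

lemma forkI:
  assumes "x \<in> X" "y \<in> X" "u \<in> X" "v \<in> X" "x \<noteq> y" "x \<noteq> u" "u \<noteq> v"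
    "delta x u < delta x y" "delta x u < delta u v"
  shows "fork X"
  using assms unfolding fork_def by blast

lemma fork_mono: "fork X \<Longrightarrow> X \<subseteq> Y \<Longrightarrow> fork Y"
  unfolding fork_def by blast

text \<open>This places a fork of a possibly infinite set inside a subset of r+2 points, where the
  colouring can detect it.\<close>

lemma fork_four_points:
  assumes "fork X"
  obtains Y where "Y \<subseteq> X" "finite Y" "card Y \<le> 4" "fork Y"
proof -
  obtain x y u v where "x \<in> X" "y \<in> X" "u \<in> X" "v \<in> X" "x \<noteq> y" "x \<noteq> u" "u \<noteq> v"
    "delta x u < delta x y" "delta x u < delta u v"
    using assms unfolding fork_def by blast
  moreover have "card {x, y, u, v} \<le> 4"
    using card_length[of "[x, y, u, v]"] by simp
  ultimately show ?thesis using that[of "{x, y, u, v}"] forkI[of x "{x, y, u, v}" y u v] by simp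
qed

text \<open>By symmetry \<open>x\<close> precedes \<open>u\<close>. Up to and including the level
  \<open>delta x u\<close>, \<open>y\<close> agrees with \<open>x\<close> and \<open>v\<close> with
  \<open>u\<close>. So all cross pairs part there in the same direction, and the two pairs can be
  sorted independently.\<close>

lemma fork_lex:
  assumes "fork X"
  obtains a b c d where "a \<in> X" "b \<in> X" "c \<in> X" "d \<in> X" "lex a b" "lex b c" "lex c d"
    "delta b c < delta a b" "delta b c < delta c d"
proof -
  obtain x y u v where *: "x \<in> X" "y \<in> X" "u \<in> X" "v \<in> X" "x \<noteq> y" "u \<noteq> v" "lex x u"
    "delta x u < delta x y" "delta x u < delta u v"
    using assms lex_linear unfolding fork_def by (metis delta_commute)
  define e where "e = delta x u"
  have cross: "lex p q \<and> delta p q = e" if "p \<in> {x, y}" "q \<in> {u, v}" for p q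
  proof -
    have e: "e \<notin> x" "e \<in> u" using *(7) delta_differ[of x u] unfolding lex_def e_def by auto
    have px: "m \<in> p \<longleftrightarrow> m \<in> x" if "m \<le> e" for m
      using \<open>p \<in> {x, y}\<close> delta_agree[of m x y] *(8) that le_less_trans unfolding e_def by blast
    have qu: "m \<in> q \<longleftrightarrow> m \<in> u" if "m \<le> e" for m
      using \<open>q \<in> {u, v}\<close> delta_agree[of m u v] *(9) that le_less_trans unfolding e_def by blast
    have ep: "e \<notin> p" "e \<in> q" using px[of e] qu[of e] e by auto
    have "delta p q = e"
    proof (rule delta_eqI)
      show "e \<in> p \<longleftrightarrow> e \<notin> q" using ep by simp
      show "m \<in> p \<longleftrightarrow> m \<in> q" if "m < e" for m
        using px[of m] qu[of m] delta_agree[of m x u] that unfolding e_def by auto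
    qed
    then show ?thesis using ep unfolding lex_def by auto
  qed
  obtain a b where ab: "a \<in> {x, y}" "b \<in> {x, y}" "lex a b" "delta a b = delta x y"
    using lex_linear[OF *(5)] delta_commute by blast
  obtain c d where cd: "c \<in> {u, v}" "d \<in> {u, v}" "lex c d" "delta c d = delta u v"
    using lex_linear[OF *(6)] delta_commute by blast
  show ?thesis
    by (rule that[of a b c d]) (use ab cd cross[OF ab(2) cd(1)] * e_def in auto)
qed

lemma valley_delta_word_Cons: "valley (delta_word xs) \<Longrightarrow> valley (delta_word (x # xs))"
  by (induction xs rule: delta_word.induct) auto

lemma valley_imp_fork:
  "sorted_wrt lex xs \<Longrightarrow> valley (delta_word xs) \<Longrightarrow> fork (set xs)"
proof (induction xs rule: delta_word.induct)
  case (1 x y z xs)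
  show ?case
  proof (cases "valley (delta_word (y # z # xs))")
    case True
    then have "fork (set (y # z # xs))" using 1 by simp
    then show ?thesis by (rule fork_mono) auto
  next
    case False
    then obtain u us where xs: "xs = u # us" using 1(3) by (cases xs) auto
    have l: "lex x y" "lex y z" "lex z u" using 1(2) xs by auto
    have "delta y z < delta x y" "delta y z < delta z u"
      using False 1(3) lex_delta_neq[OF l(1,2)] unfolding xs by auto
    then show ?thesis
      using l[THEN lex_neq] unfolding xs
      by (intro forkI[of y _ x z u]) (auto simp: delta_commute)
  qed
qed auto

text \<open>The points of a fork need not be consecutive. If there is no valley, the tail has no
  fork by induction; this forces the first two points of the sorted fork to be the first two of the
  list, and then the first four points form a valley after all.\<close>

lemma fork_imp_valley:
  "sorted_wrt lex xs \<Longrightarrow> fork (set xs) \<Longrightarrow> valley (delta_word xs)"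
proof (induction xs)
  case Nil
  then show ?case by (simp add: fork_def)
next
  case (Cons a ys)
  have a: "lex a y" if "y \<in> set ys" for y using Cons.prems that by simp
  have ys: "sorted_wrt lex ys" using Cons.prems by simp
  show ?case
  proof (rule ccontr)
    assume nv: "\<not> valley (delta_word (a # ys))"
    then have nf: "\<not> fork (set ys)" using Cons.IH[OF ys] valley_delta_word_Cons by blast
    obtain p q s t where pq: "p \<in> set (a # ys)" "q \<in> set (a # ys)" "s \<in> set (a # ys)"
      "t \<in> set (a # ys)" "lex p q" "lex q s" "lex s t" "delta q s < delta p q" "delta q s < delta s t"
      using fork_lex[OF Cons.prems(2)] by metis
    have gt: "y \<in> set ys" if "lex z y" "z \<in> set (a # ys)" "y \<in> set (a # ys)" for y z
      using that a lex_asym lex_neq by auto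
    have qst: "q \<in> set ys" "s \<in> set ys" "t \<in> set ys"
      using gt[OF pq(5) pq(1,2)] gt[OF pq(6) pq(2,3)] gt[OF pq(7) pq(3,4)] by auto
    have pa: "p = a"
    proof (rule ccontr)
      assume "p \<noteq> a"
      then have "p \<in> set ys" using pq by simp
      then have "fork (set ys)"
        using qst pq
        by (intro forkI[of q _ p s t]) (auto simp: delta_commute dest: lex_neq)
      then show False using nf by simp
    qed
    obtain b zs where b: "ys = b # zs" using qst by (cases ys) auto
    have bz: "lex b y" if "y \<in> set zs" for y using ys b that by simp
    have sz: "s \<in> set zs" "t \<in> set zs"
      using qst pq bz b lex_asym lex_neq lex_min(1) by (metis set_ConsD)+
    obtain c us where c: "zs = c # us" using sz by (cases zs) auto
    have cz: "lex c y" if "y \<in> set us" for y using ys b c that by simp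
    have tu: "t \<in> set us"
      using sz pq cz c lex_asym lex_neq by (metis set_ConsD)
    obtain d vs where d: "us = d # vs" using tu by (cases us) auto
    have l: "lex a b" "lex b c" "lex c d" using Cons.prems b c d by auto
    have cd: "delta c y \<le> delta c d" if "y \<in> set us" for y
    proof (cases "y = d")
      case False
      then have "lex d y" using that d ys b c by auto
      then show ?thesis using lex_min(2)[OF l(3)] by blast
    qed simp
    \<comment> \<open>Otherwise \<open>b\<close> could replace \<open>a\<close> as the partner of
      \<open>q\<close>, because \<open>delta b q\<close> is at least \<open>delta a q\<close>; the
      fork would lie in the tail.\<close>
    have qb: "q = b"
    proof (rule ccontr)
      assume "q \<noteq> b"
      then have "lex b q" using qst b bz by auto
      then have "delta q s < delta q b"
        using lex_min(3)[OF l(1)] pq(8) pa less_le_trans delta_commute by metis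
      then have "fork (set ys)"
        using qst b pq lex_neq \<open>q \<noteq> b\<close> by (intro forkI[of q _ b s t]) auto
      then show False using nf by simp
    qed
    have "delta b c < delta a b \<and> delta b c < delta c d"
    proof (cases "s = c")
      case True
      then show ?thesis using pq pa qb cd[OF tu] less_le_trans by blast
    next
      case False
      then have su: "s \<in> set us" using sz c by simp
      note cs = cz[OF su]
      show ?thesis
      proof (cases "delta b c < delta c s")
        case True
        then have "delta b s = delta b c" by (rule delta_less[OF lex_neq[OF l(2)]])
        then show ?thesis using pq pa qb True cd[OF su] less_le_trans by auto
      next
        case False
        \<comment> \<open>Now \<open>b\<close> and \<open>c\<close> part above the level at which
          both leave \<open>s\<close>, so together with \<open>s\<close> and \<open>t\<close> they
          fork inside the tail.\<close>
        then have "delta c s < delta c b" using lex_delta_neq[OF l(2) cs] delta_commute neq_iff by metis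
        moreover have "delta b s = delta c s"
          using False lex_min(3,4)[OF l(2) cs] lex_delta_neq[OF l(2) cs] by (metis le_less)
        ultimately have "fork (set ys)"
          using qst b c pq qb lex_neq cs l(2) by (intro forkI[of c _ b s t]) auto
        then show ?thesis using nf by simp
      qed
    qed
    then have "valley (delta_word (a # ys))"
      unfolding b c d by auto
    then show False using nv by simp
  qed
qed

section \<open>Branching levels of sets without forks\<close>

definition spectrum :: "'a set set \<Rightarrow> 'a set" where
  "spectrum X = {delta x y | x y. x \<in> X \<and> y \<in> X \<and> x \<noteq> y}"

lemma spectrumI: "x \<in> X \<Longrightarrow> y \<in> X \<Longrightarrow> x \<noteq> y \<Longrightarrow> delta x y \<in> spectrum X"
  unfolding spectrum_def by blast

lemma spectrumE:
  assumes "d \<in> spectrum X"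
  obtains x y where "x \<in> X" "y \<in> X" "x \<noteq> y" "d = delta x y"
  using assms unfolding spectrum_def by blast

lemma spectrum_subset: "X \<subseteq> Pow K \<Longrightarrow> spectrum X \<subseteq> K"
  unfolding spectrum_def using delta_mem by blast

text \<open>By the ultrametric law \<open>x\<close> leaves \<open>u\<close> or \<open>v\<close> at
  the level \<open>delta u v\<close>, unless it leaves both at one lower level; but then
  \<open>x\<close>, \<open>y\<close> and \<open>u\<close>, \<open>v\<close> would fork
  there.\<close>

lemma no_fork_split:
  assumes "\<not> fork X" "x \<in> X" "y \<in> X" "x \<noteq> y" "u \<in> X" "v \<in> X" "u \<noteq> v" "delta u v < delta x y"
  obtains z where "z \<in> {u, v}" "z \<noteq> x" "delta x z = delta u v"
proof -
  consider "x = u" | "x = v" | "x \<noteq> u" "x \<noteq> v" by blast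
  then show ?thesis
  proof cases
    case 1
    then show ?thesis using that[of v] assms(7) by simp
  next
    case 2
    then show ?thesis using that[of u] assms(7) by (simp add: delta_commute)
  next
    case 3
    consider "delta u x < delta x v" | "delta v x < delta x u" | "delta u x = delta x v"
      using neq_iff delta_commute by metis
    then show ?thesis
    proof cases
      case 1
      then have "delta u v = delta u x" using 3 delta_less by blast
      then show ?thesis using that[of u] 3 by (simp add: delta_commute)
    next
      case 2
      then have "delta v u = delta v x" using 3 delta_less by blast
      then show ?thesis using that[of v] 3 by (simp add: delta_commute)
    next
      case c: 3
      then have "delta x u < delta u v"
        using delta_eq_less[of u x v] 3 assms(7) by (simp add: delta_commute)
      moreover from this have "delta x u < delta x y" using assms(8) by (rule less_trans)
      ultimately have "fork X" using forkI[of x X y u v] assms 3 by blast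
      then show ?thesis using assms(1) by simp
    qed
  qed
qed

lemma spectrum_insert:
  assumes "z \<notin> S" "S \<noteq> {}" "\<And>s. s \<in> S \<Longrightarrow> delta s z = b"
  shows "spectrum (insert z S) = insert b (spectrum S)"
proof
  show "spectrum (insert z S) \<subseteq> insert b (spectrum S)"
    using assms(3) by (auto elim!: spectrumE intro: spectrumI simp: delta_commute)
  obtain s where "s \<in> S" using assms(2) by blast
  then have "b \<in> spectrum (insert z S)"
    using spectrumI[of s "insert z S" z] assms(1,3) by auto
  then show "insert b (spectrum S) \<subseteq> spectrum (insert z S)"
    by (auto elim!: spectrumE intro: spectrumI)
qed

text \<open>Levels are added from the top down. For a new lowest level \<open>b\<close>,
  \<open>no_fork_split\<close> gives a point that leaves one member of \<open>S\<close> at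
  \<open>b\<close>; as all levels of \<open>S\<close> are higher, it leaves every member at
  \<open>b\<close>, so exactly one level is added.\<close>

lemma spectrum_subset_realised:
  assumes nf: "\<not> fork X"
  shows "finite R \<Longrightarrow> R \<noteq> {} \<Longrightarrow> R \<subseteq> spectrum X \<Longrightarrow>
    \<exists>S\<subseteq>X. finite S \<and> card S = Suc (card R) \<and> spectrum S = R"
proof (induction R rule: finite_linorder_min_induct)
  case empty
  then show ?case by simp
next
  case (insert b A)
  obtain u v where uv: "u \<in> X" "v \<in> X" "u \<noteq> v" "b = delta u v"
    using insert.prems by (blast elim: spectrumE)
  show ?case
  proof (cases "A = {}")
    case True
    have "spectrum {u, v} = {b}"
      using uv by (auto elim!: spectrumE intro: spectrumI simp: delta_commute)
    then show ?thesis using uv True by (intro exI[of _ "{u, v}"]) simp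
  next
    case False
    then obtain S where S: "S \<subseteq> X" "finite S" "card S = Suc (card A)" "spectrum S = A"
      using insert by blast
    obtain x y where xy: "x \<in> S" "y \<in> S" "x \<noteq> y" "delta x y \<in> A"
      using False S(4) by (metis ex_in_conv spectrumE)
    have "delta u v < delta x y" using insert.hyps xy(4) uv(4) by blast
    then obtain z where z: "z \<in> {u, v}" "z \<noteq> x" "delta x z = b"
      using no_fork_split[OF nf, of x y u v] xy uv S(1) by blast
    have zS: "z \<notin> S" using spectrumI[OF xy(1), of z] z S(4) insert.hyps by blast
    have "delta s z = b" if "s \<in> S" for s
    proof (cases "s = x")
      case False
      then have "delta z x < delta x s"
        using insert.hyps(2) S(4) z(3) spectrumI[OF xy(1) that] by (simp add: delta_commute)
      then have "delta z s = delta z x" using z(2) delta_less by blast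
      then show ?thesis using z(3) delta_commute by metis
    qed (use z in simp)
    then have "spectrum (insert z S) = insert b A"
      using spectrum_insert[OF zS] xy(1) S(4) by blast
    moreover have "card (insert z S) = Suc (card (insert b A))"
      using S zS insert.hyps by auto
    ultimately show ?thesis using S z uv by (intro exI[of _ "insert z S"]) auto
  qed
qed

lemma no_fork_inj_spectrum:
  assumes nf: "\<not> fork X"
  obtains x0 h where "inj_on h (X - {x0})" "h ` (X - {x0}) \<subseteq> spectrum X"
  \<comment> \<open>If some \<open>x0\<close> lies at the end of the path of branching points, map each other point to the level at which it
    leaves \<open>x0\<close>. Otherwise every point leaves the path, and is mapped to the next level after that.\<close>
proof (cases "\<exists>x0\<in>X. \<forall>d\<in>spectrum X. \<exists>z\<in>X - {x0}. d \<le> delta x0 z")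
  case True
  then obtain x0 where x0: "x0 \<in> X" "\<And>d. d \<in> spectrum X \<Longrightarrow> \<exists>z\<in>X - {x0}. d \<le> delta x0 z" by blast
  have "y = y'" if y: "y \<in> X" "y \<noteq> x0" "y' \<in> X" "y' \<noteq> x0" "delta x0 y = delta x0 y'" for y y'
  proof (rule ccontr)
    assume ne: "y \<noteq> y'"
    then have lt: "delta x0 y < delta y y'"
      using delta_eq_less[of y x0 y'] y by (simp add: delta_commute)
    \<comment> \<open>Both \<open>y\<close>, \<open>y'\<close> and \<open>x0\<close>,
      \<open>z\<close> part only above \<open>delta x0 y\<close>, which makes a fork.\<close>
    obtain z where z: "z \<in> X" "z \<noteq> x0" "delta y y' \<le> delta x0 z"
      using x0(2)[OF spectrumI[OF y(1,3) ne]] by blast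
    have "fork X"
      using less_le_trans[OF lt z(3)] x0(1) y z lt ne by (intro forkI[of x0 X z y y']) simp_all
    then show False using nf by simp
  qed
  then have "inj_on (delta x0) (X - {x0})" by (auto intro!: inj_onI)
  moreover have "delta x0 ` (X - {x0}) \<subseteq> spectrum X" using spectrumI x0(1) by auto
  ultimately show ?thesis by (rule that)
next
  case False
  define P where "P x d \<longleftrightarrow> d \<in> spectrum X \<and> (\<forall>z\<in>X - {x}. delta x z < d)" for x d
  define h where "h x = (LEAST d. P x d)" for x
  have Ph: "P x (h x)" if x: "x \<in> X" for x
  proof -
    have "\<exists>d. P x d" using False x unfolding P_def by (auto simp: not_le)
    then show ?thesis unfolding h_def by (rule LeastI_ex)
  qed
  have h_le: "h x \<le> d" if "P x d" for x d
    using that unfolding h_def by (rule Least_le)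
  \<comment> \<open>If \<open>x\<close> is the one that leaves the path at
    \<open>delta x x'\<close>, the path goes on with \<open>x'\<close>. A later branching point with
    \<open>x'\<close> lies above all levels of \<open>x\<close>, hence is at least
    \<open>h x\<close>, yet is below \<open>h x'\<close>.\<close>
  have key: False
    if x: "x \<in> X" "x' \<in> X" "x \<noteq> x'" "h x = h x'" and max: "\<And>z. z \<in> X - {x} \<Longrightarrow> delta x z \<le> delta x x'"
    for x x'
  proof -
    obtain u v where uv: "u \<in> X" "v \<in> X" "u \<noteq> v" "h x = delta u v"
      using Ph[OF x(1)] unfolding P_def by (blast elim: spectrumE)
    have lt: "delta x z < h x" if "z \<in> X" "z \<noteq> x" for z
      using Ph[OF x(1)] that unfolding P_def by blast
    have lt': "delta x' z < h x" if "z \<in> X" "z \<noteq> x'" for z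
      using Ph[OF x(2)] that x(4) unfolding P_def by auto
    have ux: "w \<noteq> x" "w \<noteq> x'" if "w \<in> {u, v}" for w
    proof -
      define w' where "w' = (if w = u then v else u)"
      have w': "w' \<in> X" "w' \<noteq> w" "delta w w' = h x"
        using \<open>w \<in> {u, v}\<close> uv(1-3) by (auto simp: w'_def uv(4) delta_commute)
      show "w \<noteq> x" using lt[OF w'(1)] w'(2,3) by (cases "w = x") simp_all
      show "w \<noteq> x'" using lt'[OF w'(1)] w'(2,3) by (cases "w = x'") simp_all
    qed
    have xx: "delta x x' < delta u v" using lt[of x'] x uv by simp
    have d: "delta x w = delta x x' \<and> delta x x' < delta x' w" if w: "w \<in> {u, v}" for w
    proof -
      obtain w' where w': "w' \<in> {u, v}" "w \<noteq> w'" "delta w w' = delta u v"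
        using w uv(3) delta_commute by blast
      obtain z where z: "z \<in> {x, x'}" "z \<noteq> w" "delta w z = delta x x'"
        using no_fork_split[OF nf, of w w' x x'] w w' uv x xx by auto
      have wX: "w \<in> X" using w uv by blast
      have "z \<noteq> x'"
      proof
        assume "z = x'"
        then have "delta x x' < delta x w"
          using delta_eq_less[of x x' w] x z ux[OF w] by (simp add: delta_commute)
        then show False using leD[OF max[of w]] wX ux[OF w] by blast
      qed
      then have "z = x" using z by simp
      then show ?thesis
        using delta_eq_less[of x' x w] x z ux[OF w] by (simp add: delta_commute)
    qed
    have "P x (delta x' u)"
      unfolding P_def using spectrumI[OF x(2) uv(1)] ux[of u] d[of u] max le_less_trans by blast
    then have "h x \<le> delta x' u" by (rule h_le)
    then show False using leD[of "h x" "delta x' u"] lt'[of u] uv(1) ux[of u] by blast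
  qed
  \<comment> \<open>By \<open>key\<close>, each of \<open>x\<close> and \<open>x'\<close> has a
    partner from which it parts above \<open>delta x x'\<close>; the two pairs fork.\<close>
  have "inj_on h X"
  proof (rule inj_onI, rule ccontr)
    fix x x' assume x: "x \<in> X" "x' \<in> X" "h x = h x'" "x \<noteq> x'"
    obtain z where z: "z \<in> X" "z \<noteq> x" "delta x x' < delta x z"
      using key[OF x(1,2,4,3)] not_le by blast
    obtain z' where z': "z' \<in> X" "z' \<noteq> x'" "delta x' x < delta x' z'"
      using key[OF x(2,1) x(4)[symmetric] x(3)[symmetric]] not_le by blast
    have "fork X" using forkI[of x X z x' z'] x z z' by (simp add: delta_commute)
    then show False using nf by simp
  qed
  \<comment> \<open>All of \<open>X\<close> is injected here, so an arbitrary value can stand for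
    \<open>x0\<close>.\<close>
  then have "inj_on h (X - {undefined})" by (rule inj_on_diff)
  moreover have "h ` (X - {undefined}) \<subseteq> spectrum X" using Ph unfolding P_def by blast
  ultimately show ?thesis by (rule that)
qed

text \<open>The injection gives the lower bound; for the upper bound the whole spectrum is realised
  by a subset with one point more. So an (r+1)-set without fork yields an r-set, to which
  \<open>f\<close> applies.\<close>

lemma card_spectrum:
  assumes "\<not> fork S" "finite S"
  shows "card (spectrum S) = card S - 1"
proof -
  have "spectrum S \<subseteq> (\<lambda>(x, y). delta x y) ` (S \<times> S)" unfolding spectrum_def by auto
  then have fin: "finite (spectrum S)" using assms(2) finite_subset by blast
  obtain x0 h where h: "inj_on h (S - {x0})" "h ` (S - {x0}) \<subseteq> spectrum S"
    using no_fork_inj_spectrum[OF assms(1)] .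
  have "card S - 1 \<le> card (S - {x0})" using assms(2) by (simp add: card_Diff_singleton_if)
  also have "\<dots> \<le> card (spectrum S)" using card_inj_on_le[OF h fin] .
  finally have "card S - 1 \<le> card (spectrum S)" .
  moreover have "card (spectrum S) \<le> card S - 1"
  proof (cases "spectrum S = {}")
    case False
    then obtain S' where "S' \<subseteq> S" "card S' = Suc (card (spectrum S))"
      using spectrum_subset_realised[OF assms(1) fin] by blast
    then show ?thesis using card_mono[OF assms(2), of S'] by linarith
  qed simp
  ultimately show ?thesis by linarith
qed

section \<open>The stepped-up colouring\<close>

lemma fork_extra_colour_not_constant:
  assumes "fork W" "finite W" "card W = r + 2" "r \<ge> 3"
  obtains S S' where "S \<in> nsets W (Suc r)" "S' \<in> nsets W (Suc r)"
    "extra_colour r (delta_word (lex_list S)) \<noteq> extra_colour r (delta_word (lex_list S'))"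
proof -
  define xs where "xs = lex_list W"
  have xs: "sorted_wrt lex xs" "set xs = W" "length xs = r + 2"
    using lex_list[OF assms(2)] assms(3) by (auto simp: xs_def)
  have "distinct xs" using card_distinct[of xs] xs assms(3) by simp
  have ne: "xs \<noteq> []" using xs(3) by auto
  have st: "sorted_wrt lex (tl xs)" using xs(1) ne by (cases xs) auto
  have sb: "sorted_wrt lex (butlast xs)"
    using xs(1) ne by (metis append_butlast_last_id sorted_wrt_append)
  have "set (tl xs) \<in> nsets W (Suc r)" "set (butlast xs) \<in> nsets W (Suc r)"
    using \<open>distinct xs\<close> xs ne distinct_card[of "tl xs"] distinct_card[of "butlast xs"]
    by (auto simp: nsets_def distinct_tl distinct_butlast list.set_sel(2) dest: in_set_butlastD)
  moreover have "valley (delta_word xs)" using fork_imp_valley[OF xs(1)] assms(1) xs(2) by simp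
  then have "extra_colour r (tl (delta_word xs)) \<noteq> extra_colour r (butlast (delta_word xs))"
    using extra_colour_tl_neq_butlast[OF _ assms(4)] xs(3) length_delta_word by simp
  then have "extra_colour r (delta_word (lex_list (set (tl xs))))
      \<noteq> extra_colour r (delta_word (lex_list (set (butlast xs))))"
    by (simp add: lex_list_set[OF st] lex_list_set[OF sb] delta_word_tl delta_word_butlast)
  ultimately show ?thesis by (rule that)
qed

lemma valley_iff_fork: "finite S \<Longrightarrow> valley (delta_word (lex_list S)) \<longleftrightarrow> fork S"
  using fork_imp_valley[of "lex_list S"] valley_imp_fork[of "lex_list S"] lex_list[of S] by auto

lemma stepping_up:
  fixes r :: nat and K :: "'a set" and T :: "'c set" and L :: "'c \<Rightarrow> 'l set"
  assumes "r \<ge> 3"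
    and "T \<noteq> {}"
    and "\<forall>\<xi>\<in>T. (card_of {..<Suc r}, card_of (L \<xi>)) \<in> ordLeq"
    and "neg_arrow K T L r"
  shows "\<exists>g :: 'a set set \<Rightarrow> 'c + nat.
           (\<forall>S \<in> nsets (Pow K) (Suc r). g S \<in> T <+> {..<eta r}) \<and>
           \<not> (\<exists>\<xi>\<in>T. \<exists>X. X \<subseteq> Pow K \<and> (card_of X, card_of (L \<xi> <+> {()})) \<in> ordIso \<and>
                 monochromatic g (Suc r) X (Inl \<xi>)) \<and>
           \<not> (\<exists>j < eta r. \<exists>X. X \<subseteq> Pow K \<and> finite X \<and> card X = r + 2 \<and>
                 monochromatic g (Suc r) X (Inr j))"
proof -
  obtain f where f: "\<And>S. S \<in> nsets K r \<Longrightarrow> f S \<in> T"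
    and no_mono: "\<And>\<xi> X. \<xi> \<in> T \<Longrightarrow> X \<subseteq> K \<Longrightarrow> (card_of X, card_of (L \<xi>)) \<in> ordIso \<Longrightarrow>
      \<not> monochromatic f r X \<xi>"
    using assms(4) unfolding neg_arrow_def by blast
  obtain t0 where t0: "t0 \<in> T" using assms(2) by blast
  define c where "c S = extra_colour r (delta_word (lex_list S))" for S
  \<comment> \<open>For a fork with \<open>c S = None\<close> any fixed old colour \<open>t0\<close>
    will do: \<open>no_fork\<close> uses only that different values of \<open>c\<close> give
    different values of \<open>g\<close>.\<close>
  define g :: "'a set set \<Rightarrow> 'c + nat" where
    "g S = (case c S of Some j \<Rightarrow> Inr j | None \<Rightarrow> Inl (if fork S then t0 else f (spectrum S)))" for S
  have g_no_fork: "g S = Inl (f (spectrum S))" if "finite S" "\<not> fork S" for S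
    using that valley_iff_fork[of S] by (simp add: g_def c_def extra_colour_def)
  have no_fork: "\<not> fork W"
    if m: "monochromatic g (Suc r) X col" and W: "W \<subseteq> X" "finite W" "card W = r + 2" for X W col
  proof
    assume "fork W"
    then obtain S S' where S: "S \<in> nsets W (Suc r)" "S' \<in> nsets W (Suc r)" "c S \<noteq> c S'"
      unfolding c_def using fork_extra_colour_not_constant[OF _ W(2,3) assms(1)] by metis
    have "S \<in> nsets X (Suc r)" "S' \<in> nsets X (Suc r)"
      using S W(1) nsets_mono by blast+
    then have "g S = g S'" using m unfolding monochromatic_def by simp
    then show False using S(3) by (auto simp: g_def split: option.splits)
  qed
  have range: "g S \<in> T <+> {..<eta r}" if S: "S \<in> nsets (Pow K) (Suc r)" for S
  proof -
    have S': "S \<subseteq> Pow K" "finite S" "card S = Suc r" using S by (auto simp: nsets_def)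
    show ?thesis
    proof (cases "c S")
      case (Some j)
      have "length (delta_word (lex_list S)) = r - 1"
        using S' lex_list(3) length_delta_word by simp
      then have "j < eta r" using Some assms(1) extra_colour_less_eta unfolding c_def by blast
      then show ?thesis using Some by (auto simp: g_def)
    next
      case None
      have "f (spectrum S) \<in> T" if "\<not> fork S"
      proof (rule f)
        have "card (spectrum S) = r" using card_spectrum[OF that S'(2)] S'(3) by simp
        moreover from this have "finite (spectrum S)" using assms(1) card.infinite by fastforce
        ultimately show "spectrum S \<in> nsets K r"
          using spectrum_subset[OF S'(1)] by (simp add: nsets_def)
      qed
      then show ?thesis using None t0 by (auto simp: g_def)
    qed
  qed
  have extra: "\<not> monochromatic g (Suc r) X (Inr j)" if X: "finite X" "card X = r + 2" for X j
  proof
    assume m: "monochromatic g (Suc r) X (Inr j)"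
    obtain S where S: "S \<subseteq> X" "card S = Suc r" "finite S"
      using obtain_subset_with_card_n[of "Suc r" X] X by auto
    have "\<not> fork S" using no_fork[OF m subset_refl X] fork_mono S(1) by blast
    then have "g S = Inl (f (spectrum S))" using g_no_fork S(3) by blast
    moreover have "g S = Inr j" using m S unfolding monochromatic_def by (simp add: nsets_def)
    ultimately show False by simp
  qed
  have main: "\<not> monochromatic g (Suc r) X (Inl \<xi>)"
    if \<xi>: "\<xi> \<in> T" and X: "X \<subseteq> Pow K" "(card_of X, card_of (L \<xi> <+> {()})) \<in> ordIso" for \<xi> X
  proof
    assume m: "monochromatic g (Suc r) X (Inl \<xi>)"
    obtain i where i: "inj_on i {..<Suc r}" "i ` {..<Suc r} \<subseteq> L \<xi>"
      using assms(3) \<xi> card_of_ordLeq[of "{..<Suc r}" "L \<xi>"] by blast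
    obtain b where b: "bij_betw b (L \<xi> <+> {()}) X"
      using ordIso_symmetric[OF X(2)] card_of_ordIso[of "L \<xi> <+> {()}" X] by blast
    have b_inj: "inj_on b (L \<xi> <+> {()})" and b_img: "b ` (L \<xi> <+> {()}) = X"
      using b by (auto simp: bij_betw_def)
    have "\<not> fork X"
    proof
      assume "fork X"
      then obtain Y where Y: "Y \<subseteq> X" "finite Y" "card Y \<le> 4" "fork Y" by (rule fork_four_points)
      \<comment> \<open>The r+1 elements of \<open>L \<xi>\<close> and the extra unit index give r+2
        points of \<open>X\<close>, enough to enlarge the at most four points of the fork to a set
        \<open>W\<close> of that size.\<close>
      define I where "I = i ` {..<Suc r} <+> {()}"
      have I: "I \<subseteq> L \<xi> <+> {()}" "finite I" "card I = r + 2"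
        using i by (auto simp: I_def card_Plus card_image)
      have "card (b ` I) = r + 2" using I b_inj by (metis card_image inj_on_subset)
      then have "r + 2 \<le> card (Y \<union> b ` I)" using I(2) Y(2) by (metis card_mono finite_UnI finite_imageI sup_ge2)
      moreover have "card Y \<le> r + 2" using Y(3) assms(1) by simp
      ultimately obtain W where W: "Y \<subseteq> W" "W \<subseteq> Y \<union> b ` I" "card W = r + 2"
        using exists_subset_between[of Y "r + 2" "Y \<union> b ` I"] I(2) Y(2) by blast
      have "finite W" using W(2) I(2) Y(2) finite_subset by blast
      moreover have "W \<subseteq> X" using W(2) Y(1) I(1) b_img by blast
      ultimately show False using no_fork[OF m _ _ W(3)] fork_mono[OF Y(4) W(1)] by blast
    qed
    note nf = this
    obtain x0 h where h: "inj_on h (X - {x0})" "h ` (X - {x0}) \<subseteq> spectrum X"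
      by (rule no_fork_inj_spectrum[OF nf])
    \<comment> \<open>The extra index replaces the one, if any, that names \<open>x0\<close>. This
      embeds \<open>L \<xi>\<close> into \<open>X - {x0}\<close> uniformly for finite and infinite
      cardinals.\<close>
    define k where "k l = (if b (Inl l) = x0 then b (Inr ()) else b (Inl l))" for l
    have b_eq: "b p = b q \<longleftrightarrow> p = q" if "p \<in> L \<xi> <+> {()}" "q \<in> L \<xi> <+> {()}" for p q
      using b_inj that by (meson inj_onD)
    have k_inj: "inj_on k (L \<xi>)"
      by (rule inj_onI) (auto simp: k_def b_eq InlI InrI split: if_splits)
    have k_img: "k ` L \<xi> \<subseteq> X - {x0}"
      using b_img by (auto simp: k_def b_eq InlI InrI)
    define D where "D = (h \<circ> k) ` L \<xi>"
    have "inj_on (h \<circ> k) (L \<xi>)"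
      using k_inj k_img h(1) by (blast intro: comp_inj_on inj_on_subset)
    then have "bij_betw (h \<circ> k) (L \<xi>) D" by (simp add: bij_betw_def D_def)
    then have "(card_of D, card_of (L \<xi>)) \<in> ordIso"
      using card_of_ordIso ordIso_symmetric by blast
    moreover have DX: "D \<subseteq> spectrum X" using k_img h(2) unfolding D_def by auto
    then have "D \<subseteq> K" using spectrum_subset[OF X(1)] by blast
    moreover have "monochromatic f r D \<xi>"
      unfolding monochromatic_def
    proof
      \<comment> \<open>Every r-subset of \<open>D\<close> is the spectrum of an (r+1)-subset of
        \<open>X\<close>, so its \<open>f\<close>-colour is read off from \<open>g\<close>.\<close>
      fix R assume R: "R \<in> nsets D r"
      then have R': "R \<subseteq> D" "finite R" "card R = r" by (auto simp: nsets_def)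
      have "R \<noteq> {}" using R'(3) assms(1) by auto
      then obtain S where S: "S \<subseteq> X" "finite S" "card S = Suc r" "spectrum S = R"
        using spectrum_subset_realised[OF nf R'(2)] R' DX by blast
      have "g S = Inl \<xi>" using m S unfolding monochromatic_def by (simp add: nsets_def)
      moreover have "g S = Inl (f (spectrum S))"
        using g_no_fork[OF S(2)] nf fork_mono S(1) by blast
      ultimately show "f R = \<xi>" using S(4) by simp
    qed
    ultimately show False using no_mono[OF \<xi>] by blast
  qed
  show ?thesis using range main extra by blast
qed

end

theorem theoremA1:
  fixes r :: nat and K :: "'a set" and T :: "'c set" and L :: "'c \<Rightarrow> 'l set"
  assumes "r \<ge> 3"
    and "K \<noteq> {}"
    and "T \<noteq> {}"
    and "\<forall>\<xi>\<in>T. (card_of {..<Suc r}, card_of (L \<xi>)) \<in> ordLeq"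
    and "neg_arrow K T L r"
  shows "\<exists>g :: 'a set set \<Rightarrow> 'c + nat.
           (\<forall>S \<in> nsets (Pow K) (Suc r). g S \<in> T <+> {..<eta r}) \<and>
           \<not> (\<exists>\<xi>\<in>T. \<exists>X. X \<subseteq> Pow K \<and> (card_of X, card_of (L \<xi> <+> {()})) \<in> ordIso \<and>
                 monochromatic g (Suc r) X (Inl \<xi>)) \<and>
           \<not> (\<exists>j < eta r. \<exists>X. X \<subseteq> Pow K \<and> finite X \<and> card X = r + 2 \<and>
                 monochromatic g (Suc r) X (Inr j))"
proof -
  \<comment> \<open>Any well-order of the whole type serves: it is used only to compare points and
    to take first differences.\<close>
  obtain R :: "'a rel" where R: "Well_order R" "Field R = UNIV"
    using well_ordering by metis
  have lin: "Linear_order R" and wf: "wf (R - Id)" using R(1) by (auto simp: well_order_on_def)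
  have refl: "(x, x) \<in> R" for x
    using lin R(2) by (auto simp: order_on_defs refl_on_def)
  have trans: "(x, z) \<in> R" if "(x, y) \<in> R" "(y, z) \<in> R" for x y z
    using lin that by (auto simp: order_on_defs dest: transD)
  have antisym: "x = y" if "(x, y) \<in> R" "(y, x) \<in> R" for x y
    using lin that by (auto simp: order_on_defs dest: antisymD)
  have total: "(x, y) \<in> R \<or> (y, x) \<in> R" for x y
    using lin R(2) refl by (cases "x = y") (auto simp: order_on_defs total_on_def)
  interpret W: wellorder "\<lambda>x y. (x, y) \<in> R" "\<lambda>x y. (x, y) \<in> R - Id"
  proof
    fix x y z
    show "(x, y) \<in> R - Id \<longleftrightarrow> (x, y) \<in> R \<and> (y, x) \<notin> R" using antisym refl by auto
    show "(x, x) \<in> R" by (rule refl)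
    show "(x, z) \<in> R" if "(x, y) \<in> R" "(y, z) \<in> R" using that by (rule trans)
    show "x = y" if "(x, y) \<in> R" "(y, x) \<in> R" using that by (rule antisym)
    show "(x, y) \<in> R \<or> (y, x) \<in> R" by (rule total)
  next
    fix P a
    assume "\<And>x. (\<And>y. (y, x) \<in> R - Id \<Longrightarrow> P y) \<Longrightarrow> P x"
    then show "P a" using wf_induct_rule[OF wf] by blast
  qed
  show ?thesis by (rule W.stepping_up[OF assms(1,3-5)])
qed

end
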